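(* Let $n$ be a positive integer and let $f\colon X\to X$ be an $n$-expansive homeomorphism of a compact metric space $(X,d)$. If $f$ has the shadowing property, then for each $x\in X$ there exists $\varepsilon_x>0$ such that $$W^s_{\varepsilon_x}(f^m(x))\subset W^s(f^m(x))$$ for every $m\in\mathbb{Z}$.
   Context: Here $\mathbb{N}=\{1,2,\dots\}$. $n$-expansive: $f$ is $n$-expansive if there exists $c>0$ such that for every $x\in X$ the set $\Gamma(x,c)=\{y\in X : d(f^k(x),f^k(y))\le c \text{ for all } k\in\mathbb{Z}\}$ contains at most $n$ different points. Shadowing property: a sequence $(x_k)_{k\in\mathbb{Z}}\subset X$ is a $\delta$-pseudo-orbit if $d(f(x_k),x_{k+1})<\delta$ for all $k\in\mathbb{Z}$; it is $\varepsilon$-shadowed if there is $y\in X$ with $d(f^k(y),x_k)<\varepsilon$ for all $k\in\mathbb{Z}$. $f$ has the shadowing property if for every $\varepsilon>0$ there is $\delta>0$ such that every $\delta$-pseudo-orbit is $\varepsilon$-shadowed. Stable sets: $W^s(x)=\{y\in X : d(f^k(y),f^k(x))\to 0 \text{ as } k\to\infty\}$, and for $\varepsilon>0$, $W^s_\varepsilon(x)=\{y\in X : d(f^k(y),f^k(x))\le\varepsilon \text{ for all } k\in\mathbb{N}\}$. *)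

theory Defs
  imports "HOL-Analysis.Analysis"
begin

text \<open>
  A metric space is given by its carrier \<open>X\<close>, a subset of a type of class
  \<open>metric_space\<close>, with the restricted metric. A self-map of \<open>X\<close> is a total function
  \<open>f\<close> whose values outside \<open>X\<close> are irrelevant: in all definitions the points range over \<open>X\<close> only.
\<close>

text \<open>
  \<open>int_iter X f k\<close> is \<open>f\<^sup>k\<close> for an integer \<open>k\<close>. It is meaningful on \<open>X\<close>, for \<open>f\<close> a bijection
  of \<open>X\<close>; negative iterates are those of the inverse of \<open>f\<close> on \<open>X\<close>.
\<close>

definition int_iter :: "'a set \<Rightarrow> ('a \<Rightarrow> 'a) \<Rightarrow> int \<Rightarrow> 'a \<Rightarrow> 'a" where
  "int_iter X f k = (if 0 \<le> k then f ^^ nat k else inv_into X f ^^ nat (- k))"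

definition dynamic_ball ::
    "'a::metric_space set \<Rightarrow> ('a \<Rightarrow> 'a) \<Rightarrow> 'a \<Rightarrow> real \<Rightarrow> 'a set" where
  "dynamic_ball X f x c =
     {y \<in> X. \<forall>k::int. dist (int_iter X f k x) (int_iter X f k y) \<le> c}"

definition n_expansive :: "nat \<Rightarrow> 'a::metric_space set \<Rightarrow> ('a \<Rightarrow> 'a) \<Rightarrow> bool" where
  "n_expansive n X f \<longleftrightarrow>
     (\<exists>c>0. \<forall>x\<in>X. finite (dynamic_ball X f x c) \<and> card (dynamic_ball X f x c) \<le> n)"

definition pseudo_orbit ::
    "'a::metric_space set \<Rightarrow> ('a \<Rightarrow> 'a) \<Rightarrow> real \<Rightarrow> (int \<Rightarrow> 'a) \<Rightarrow> bool" where
  "pseudo_orbit X f \<delta> \<xi> \<longleftrightarrow>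
     (\<forall>k. \<xi> k \<in> X) \<and> (\<forall>k. dist (f (\<xi> k)) (\<xi> (k + 1)) < \<delta>)"

definition shadowed ::
    "'a::metric_space set \<Rightarrow> ('a \<Rightarrow> 'a) \<Rightarrow> real \<Rightarrow> (int \<Rightarrow> 'a) \<Rightarrow> bool" where
  "shadowed X f \<epsilon> \<xi> \<longleftrightarrow> (\<exists>y\<in>X. \<forall>k. dist (int_iter X f k y) (\<xi> k) < \<epsilon>)"

definition shadowing_property :: "'a::metric_space set \<Rightarrow> ('a \<Rightarrow> 'a) \<Rightarrow> bool" where
  "shadowing_property X f \<longleftrightarrow>
     (\<forall>\<epsilon>>0. \<exists>\<delta>>0. \<forall>\<xi>. pseudo_orbit X f \<delta> \<xi> \<longrightarrow> shadowed X f \<epsilon> \<xi>)"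

definition stable_set :: "'a::metric_space set \<Rightarrow> ('a \<Rightarrow> 'a) \<Rightarrow> 'a \<Rightarrow> 'a set" where
  "stable_set X f x =
     {y \<in> X. (\<lambda>k. dist ((f ^^ k) y) ((f ^^ k) x)) \<longlonglongrightarrow> 0}"

text \<open>In the local stable set the iterates start at \<open>k = 1\<close>: the natural numbers exclude \<open>0\<close>.\<close>

definition local_stable_set ::
    "'a::metric_space set \<Rightarrow> ('a \<Rightarrow> 'a) \<Rightarrow> real \<Rightarrow> 'a \<Rightarrow> 'a set" where
  "local_stable_set X f \<epsilon> x =
     {y \<in> X. \<forall>k\<ge>1. dist ((f ^^ k) y) ((f ^^ k) x) \<le> \<epsilon>}"

end

theory Submission
  imports Defs
begin

text \<open>
  The proof compares forward orbits with the forward orbit of \<open>x\<close>, in terms of their distance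
  \<open>d\<^sub>k\<close> at time \<open>k\<close>. Let \<open>c\<close> be a constant of \<open>n\<close>-expansivity, so that \<open>n + 1\<close> distinct points
  cannot have full orbits that stay \<open>c\<close>-close to one of them. Two consequences of this count are
  combined.

  Shadowing excludes oscillation (\<open>proximal_imp_asymptotic\<close>): if eventually \<open>d\<^sub>k \<le> c / 4\<close> and
  \<open>d\<^sub>k\<close> comes arbitrarily close to \<open>0\<close>, then \<open>d\<^sub>k \<longlonglongrightarrow> 0\<close>. Otherwise the two orbits meet up to
  \<open>\<delta>\<close> at infinitely many times and are a fixed distance apart at times in between. Jumping from
  one orbit to the other at any of the meeting times is a \<open>\<delta>\<close>-pseudo-orbit. Different jump times
  are told apart at an intermediate time, so the shadowing points are pairwise distinct, but
  all their orbits stay \<open>c\<close>-close: too many points.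

  Compactness excludes too many separated orbits (\<open>no_separated_forward_orbits\<close>): \<open>n + 1\<close>
  forward orbits that are eventually \<open>c\<close>-close cannot be pairwise bounded away from each other,
  since a simultaneous limit of them along a subsequence of times would consist of \<open>n + 1\<close>
  distinct points whose full orbits are \<open>c\<close>-close.

  Suppose now that no \<open>\<epsilon>\<close> works for \<open>x\<close>. Moved to time \<open>0\<close> along the orbit, the counterexamples
  give, for each \<open>\<epsilon>\<close>, a point whose forward orbit is eventually \<open>\<epsilon>\<close>-close to that of \<open>x\<close>
  without being asymptotic to it; here the time \<open>m\<close> is absorbed by the word ``eventually'', and this is
  why one \<open>\<epsilon>\<close> serves all \<open>m\<close>. By the first consequence such an orbit ends up in an annulus
  \<open>s \<le> d\<^sub>k \<le> \<epsilon>\<close> with \<open>s > 0\<close>. Repeating this with \<open>\<epsilon>\<close> small compared with the previous \<open>s\<close>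
  produces \<open>n + 1\<close> orbits in nested, separated annuli, against the second consequence.
\<close>

section \<open>Integer iterates of a homeomorphism\<close>

locale compact_homeomorphism =
  fixes X :: "'a::metric_space set" and f :: "'a \<Rightarrow> 'a"
  assumes compact_carrier: "compact X"
    and homeo: "homeomorphism X X f (inv_into X f)"
begin

abbreviation iter :: "int \<Rightarrow> 'a \<Rightarrow> 'a" where
  "iter \<equiv> int_iter X f"

lemma map_in: "x \<in> X \<Longrightarrow> f x \<in> X"
  using homeo by (auto simp: homeomorphism_def)

lemma inv_in: "x \<in> X \<Longrightarrow> inv_into X f x \<in> X"
  using homeo by (auto simp: homeomorphism_def)

lemma map_inv: "x \<in> X \<Longrightarrow> f (inv_into X f x) = x"
  using homeo by (auto simp: homeomorphism_def)

lemma inv_map: "x \<in> X \<Longrightarrow> inv_into X f (f x) = x"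
  using homeo by (auto simp: homeomorphism_def)

lemma funpow_in: "x \<in> X \<Longrightarrow> (f ^^ k) x \<in> X"
  by (induction k) (auto simp: map_in)

lemma inv_funpow_in: "x \<in> X \<Longrightarrow> (inv_into X f ^^ k) x \<in> X"
  by (induction k) (auto simp: inv_in)

lemma iter_in: "x \<in> X \<Longrightarrow> iter k x \<in> X"
  by (simp add: int_iter_def funpow_in inv_funpow_in)

lemma iter_of_nat: "iter (int k) x = (f ^^ k) x"
  by (simp add: int_iter_def)

lemma iter_Suc:
  assumes "x \<in> X"
  shows "iter (k + 1) x = f (iter k x)"
proof (cases "0 \<le> k")
  case True
  then have "nat (k + 1) = Suc (nat k)" by simp
  with True show ?thesis by (simp add: int_iter_def)
next
  case False
  define j where "j = nat (- (k + 1))"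
  have "nat (- k) = Suc j" using False by (simp add: j_def)
  then have "f (iter k x) = (inv_into X f ^^ j) x"
    using False assms by (simp add: int_iter_def map_inv inv_funpow_in)
  also have "\<dots> = iter (k + 1) x"
    using False by (cases "k = -1") (auto simp: int_iter_def j_def)
  finally show ?thesis ..
qed

lemma iter_pred:
  assumes "x \<in> X"
  shows "iter (k - 1) x = inv_into X f (iter k x)"
  using iter_Suc[OF assms, of "k - 1"] inv_map[OF iter_in[OF assms, of "k - 1"]] by simp

lemma iter_add:
  assumes "x \<in> X"
  shows "iter (a + b) x = iter a (iter b x)"
proof (induction a rule: int_induct[where k = 0])
  case base
  show ?case by (simp add: int_iter_def)
next
  case (step1 i)
  have "iter (i + 1 + b) x = f (iter (i + b) x)"
    using iter_Suc[OF assms, of "i + b"] by (simp add: ac_simps)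
  then show ?case using step1 iter_Suc[OF iter_in[OF assms], of i b] by simp
next
  case (step2 i)
  have "iter (i - 1 + b) x = inv_into X f (iter (i + b) x)"
    using iter_pred[OF assms, of "i + b"] by (simp add: algebra_simps)
  then show ?case using step2 iter_pred[OF iter_in[OF assms], of i b] by simp
qed

lemma continuous_on_iter: "continuous_on X (iter k)"
proof -
  have pow: "continuous_on X (g ^^ j)"
    if "continuous_on X g" "\<And>x. x \<in> X \<Longrightarrow> g x \<in> X" for g :: "'a \<Rightarrow> 'a" and j
  proof (induction j)
    case (Suc j)
    have "(g ^^ j) ` X \<subseteq> X" using that(2) by (induction j) auto
    then have "continuous_on X (g \<circ> g ^^ j)"
      using Suc that(1) by (blast intro: continuous_on_compose continuous_on_subset)
    then show ?case by simp
  qed (auto simp: id_def)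
  show ?thesis
    using pow[of f] pow[of "inv_into X f"] homeo
    by (simp add: int_iter_def map_in inv_in homeomorphism_def)
qed

section \<open>Simultaneous limits of finitely many orbits\<close>

lemma simultaneous_convergent_subsequence:
  fixes u :: "nat \<Rightarrow> nat \<Rightarrow> 'a"
  assumes "\<And>i k. i < N \<Longrightarrow> u i k \<in> X"
  shows "\<exists>r p. strict_mono (r :: nat \<Rightarrow> nat) \<and>
           (\<forall>i<N. p i \<in> X \<and> (\<lambda>k. u i (r k)) \<longlonglongrightarrow> p i)"
  using assms
proof (induction N)
  case 0
  show ?case using strict_mono_id by auto
next
  case (Suc N)
  then obtain r p where r: "strict_mono (r :: nat \<Rightarrow> nat)"
    and p: "\<And>i. i < N \<Longrightarrow> p i \<in> X \<and> (\<lambda>k. u i (r k)) \<longlonglongrightarrow> p i"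
    by (metis less_SucI)
  have "\<forall>k. u N (r k) \<in> X" using Suc.prems by simp
  then obtain q s where q: "q \<in> X" and s: "strict_mono (s :: nat \<Rightarrow> nat)"
    and lim: "((\<lambda>k. u N (r k)) \<circ> s) \<longlonglongrightarrow> q"
    using compact_carrier[unfolded compact_def] by meson
  have "(p(N := q)) i \<in> X \<and> (\<lambda>k. u i ((r \<circ> s) k)) \<longlonglongrightarrow> (p(N := q)) i" if "i < Suc N" for i
  proof (cases "i = N")
    case True
    then show ?thesis using q lim by (simp add: o_def)
  next
    case False
    then have "i < N" using that by simp
    then show ?thesis
      using p[of i] LIMSEQ_subseq_LIMSEQ[OF _ s, of "\<lambda>k. u i (r k)"] by (simp add: o_def)
  qed
  then show ?case using strict_mono_o[OF r s] by blast
qed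

text \<open>
  Any joint limit of forward orbits along times tending to infinity carries bounds
  that hold eventually in the future over to all integer times, past ones included.
\<close>

lemma dist_iter_limits_le:
  assumes zw: "z \<in> X" "w \<in> X" and pq: "p \<in> X" "q \<in> X"
    and r: "strict_mono (r :: nat \<Rightarrow> nat)"
    and zp: "(\<lambda>k. (f ^^ r k) z) \<longlonglongrightarrow> p" and wq: "(\<lambda>k. (f ^^ r k) w) \<longlonglongrightarrow> q"
    and le: "eventually (\<lambda>k. dist ((f ^^ k) z) ((f ^^ k) w) \<le> c) sequentially"
  shows "dist (iter m p) (iter m q) \<le> c"
proof -
  have lim: "(\<lambda>k. iter m ((f ^^ r k) y)) \<longlonglongrightarrow> iter m l"
    if "y \<in> X" "l \<in> X" "(\<lambda>k. (f ^^ r k) y) \<longlonglongrightarrow> l" for y l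
    using continuous_on_tendsto_compose[OF continuous_on_iter that(3,2)] that(1)
    by (simp add: funpow_in)
  obtain K where K: "\<And>k. k \<ge> K \<Longrightarrow> dist ((f ^^ k) z) ((f ^^ k) w) \<le> c"
    using le by (auto simp: eventually_sequentially)
  have "dist (iter m ((f ^^ r k) z)) (iter m ((f ^^ r k) w)) \<le> c" if "k \<ge> K + nat (- m)" for k
  proof -
    have ge: "m + int (r k) \<ge> int K" using that seq_suble[OF r, of k] by linarith
    have shift: "iter m ((f ^^ r k) y) = (f ^^ nat (m + int (r k))) y" if "y \<in> X" for y
      using iter_add[OF that, of m "int (r k)"] ge by (simp add: iter_of_nat int_iter_def)
    show ?thesis using K[of "nat (m + int (r k))"] ge by (simp add: shift zw)
  qed
  then have "eventually (\<lambda>k. dist (iter m ((f ^^ r k) z)) (iter m ((f ^^ r k) w)) \<le> c) sequentially"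
    by (auto simp: eventually_sequentially)
  then show ?thesis
    by (rule tendsto_upperbound[OF tendsto_dist[OF lim[OF zw(1) pq(1) zp] lim[OF zw(2) pq(2) wq]]])
      simp
qed

end

section \<open>Two consequences of counting points in dynamic balls\<close>

locale n_expansive_homeomorphism = compact_homeomorphism +
  fixes n :: nat and c :: real
  assumes c_pos: "c > 0"
    and dynamic_ball_small:
      "x \<in> X \<Longrightarrow> finite (dynamic_ball X f x c) \<and> card (dynamic_ball X f x c) \<le> n"
begin

lemma no_close_orbits:
  assumes "\<And>i. i \<le> n \<Longrightarrow> y i \<in> X"
    and "\<And>i j. i < j \<Longrightarrow> j \<le> n \<Longrightarrow> y i \<noteq> y j"
    and "\<And>i k. i \<le> n \<Longrightarrow> dist (iter k (y 0)) (iter k (y i)) \<le> c"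
  shows False
proof -
  have "inj_on y {..n}"
    using assms(2) by (auto intro: linorder_inj_onI)
  moreover have "y ` {..n} \<subseteq> dynamic_ball X f (y 0) c"
    using assms(1,3) by (auto simp: dynamic_ball_def)
  ultimately have "card {..n} \<le> card (dynamic_ball X f (y 0) c)"
    using dynamic_ball_small[OF assms(1)[of 0]] by (metis card_image card_mono zero_le)
  then show False using dynamic_ball_small[OF assms(1)[of 0]] by simp
qed

lemma no_separated_forward_orbits:
  assumes z: "\<And>i. i \<le> n \<Longrightarrow> z i \<in> X"
    and close: "\<And>i. i \<le> n \<Longrightarrow>
      eventually (\<lambda>k. dist ((f ^^ k) (z 0)) ((f ^^ k) (z i)) \<le> c) sequentially"
    and sep: "\<And>i j. i < j \<Longrightarrow> j \<le> n \<Longrightarrow>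
      \<exists>g>0. eventually (\<lambda>k. g \<le> dist ((f ^^ k) (z i)) ((f ^^ k) (z j))) sequentially"
  shows False
proof -
  obtain r p where r: "strict_mono (r :: nat \<Rightarrow> nat)"
    and p: "\<And>i. i \<le> n \<Longrightarrow> p i \<in> X" "\<And>i. i \<le> n \<Longrightarrow> (\<lambda>k. (f ^^ r k) (z i)) \<longlonglongrightarrow> p i"
    using simultaneous_convergent_subsequence[of "Suc n" "\<lambda>i k. (f ^^ k) (z i)"] z funpow_in
    unfolding less_Suc_eq_le by metis
  show False
  proof (rule no_close_orbits[of p])
    show "p i \<noteq> p j" if ij: "i < j" "j \<le> n" for i j
    proof -
      obtain g where g: "g > 0"
        and ev: "eventually (\<lambda>k. g \<le> dist ((f ^^ k) (z i)) ((f ^^ k) (z j))) sequentially"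
        using sep[OF ij] by blast
      have "(\<lambda>k. dist ((f ^^ r k) (z i)) ((f ^^ r k) (z j))) \<longlonglongrightarrow> dist (p i) (p j)"
        using ij p(2) by (intro tendsto_dist) auto
      then have "g \<le> dist (p i) (p j)"
        by (rule tendsto_lowerbound[OF _ eventually_subseq[OF r ev]]) simp
      then show ?thesis using g by auto
    qed
    show "dist (iter k (p 0)) (iter k (p i)) \<le> c" if "i \<le> n" for i k
      using dist_iter_limits_le[OF z z p(1) p(1) r p(2) p(2) close] that by blast
  qed (use p in auto)
qed

text \<open>
  The pseudo-orbits follow \<open>x\<close> in the past and change over to \<open>z\<close> at a time when the two
  orbits are \<open>\<delta>\<close>-close. As a single change suffices, a pseudo-orbit is determined by its time.
\<close>

lemma proximal_imp_asymptotic: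
  assumes shadowing: "shadowing_property X f"
    and x: "x \<in> X" and z: "z \<in> X"
    and close: "eventually (\<lambda>k. dist ((f ^^ k) z) ((f ^^ k) x) \<le> c / 4) sequentially"
    and proximal: "\<And>e. e > 0 \<Longrightarrow> frequently (\<lambda>k. dist ((f ^^ k) z) ((f ^^ k) x) < e) sequentially"
  shows "(\<lambda>k. dist ((f ^^ k) z) ((f ^^ k) x)) \<longlonglongrightarrow> 0"
proof (rule ccontr)
  let ?d = "\<lambda>k. dist ((f ^^ k) z) ((f ^^ k) x)"
  assume "\<not> ?d \<longlonglongrightarrow> 0"
  then obtain e where e: "e > 0" and far: "\<And>N. \<exists>l\<ge>N. e \<le> ?d l"
    by (auto simp: lim_sequentially not_less)
  obtain K where K: "\<And>k. k \<ge> K \<Longrightarrow> ?d k \<le> c / 4"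
    using close by (auto simp: eventually_sequentially)
  (* Two shadowing points must stay apart when their pseudo-orbits are e apart, and c-close when
     these are c/4-close. *)
  define \<eta> where "\<eta> = min (e / 3) (c / 4)"
  have \<eta>: "\<eta> > 0" "3 * \<eta> \<le> e" "4 * \<eta> \<le> c" using e c_pos by (auto simp: \<eta>_def)
  obtain \<delta> where \<delta>: "\<delta> > 0" and shadow: "\<And>\<xi>. pseudo_orbit X f \<delta> \<xi> \<Longrightarrow> shadowed X f \<eta> \<xi>"
    using shadowing \<eta>(1) unfolding shadowing_property_def by blast
  have meet: "\<exists>k\<ge>N. ?d k < \<delta>" for N
    using proximal[OF \<delta>] by (auto simp: frequently_sequentially)
  have "\<exists>t. \<forall>i. (t i \<ge> K \<and> ?d (t i) < \<delta>) \<and>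
      (t i < t (Suc i) \<and> (\<exists>l. t i \<le> l \<and> l < t (Suc i) \<and> e \<le> ?d l))"
  proof (rule dependent_nat_choice)
    show "\<exists>a. a \<ge> K \<and> ?d a < \<delta>" using meet by blast
  next
    fix a and i :: nat assume "a \<ge> K \<and> ?d a < \<delta>"
    obtain l where l: "l \<ge> a" "e \<le> ?d l" using far by blast
    obtain b where "b \<ge> Suc l" "?d b < \<delta>" using meet by blast
    then show "\<exists>b. (b \<ge> K \<and> ?d b < \<delta>) \<and> (a < b \<and> (\<exists>l. a \<le> l \<and> l < b \<and> e \<le> ?d l))"
      using l \<open>a \<ge> K \<and> ?d a < \<delta>\<close> by (intro exI[of _ b]) auto
  qed
  then obtain t where tK: "\<And>i. t i \<ge> K" and t\<delta>: "\<And>i. ?d (t i) < \<delta>"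
    and tless: "\<And>i. t i < t (Suc i)"
    and tfar: "\<And>i. \<exists>l. t i \<le> l \<and> l < t (Suc i) \<and> e \<le> ?d l"
    by metis
  have tmono: "t i \<le> t j" if "i \<le> j" for i j
    using lift_Suc_mono_le[of t, OF less_imp_le[OF tless] that] .
  define \<xi> where "\<xi> i k = (if int (t i) \<le> k then iter k z else iter k x)" for i k
  have "pseudo_orbit X f \<delta> (\<xi> i)" for i
    unfolding pseudo_orbit_def
  proof (intro conjI allI)
    fix k
    show "\<xi> i k \<in> X" using x z by (simp add: \<xi>_def iter_in)
    (* The only jump is the one into time t i. *)
    consider "k + 1 = int (t i)" | "k + 1 \<noteq> int (t i)" by blast
    then show "dist (f (\<xi> i k)) (\<xi> i (k + 1)) < \<delta>"
    proof cases
      case 1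
      then have "f (\<xi> i k) = (f ^^ t i) x" "\<xi> i (k + 1) = (f ^^ t i) z"
        by (simp_all add: \<xi>_def iter_Suc[OF x, symmetric] iter_of_nat)
      then show ?thesis using t\<delta>[of i] by (simp add: dist_commute)
    next
      case 2
      then have "f (\<xi> i k) = \<xi> i (k + 1)"
        using x z by (auto simp: \<xi>_def iter_Suc)
      then show ?thesis using \<delta> by simp
    qed
  qed
  then have "\<forall>i. \<exists>y\<in>X. \<forall>k. dist (iter k y) (\<xi> i k) < \<eta>"
    using shadow unfolding shadowed_def by blast
  then obtain y where y: "\<And>i. y i \<in> X" and y\<xi>: "\<And>i k. dist (iter k (y i)) (\<xi> i k) < \<eta>"
    by metis
  show False
  proof (rule no_close_orbits[of y])
    show "y i \<noteq> y j" if "i < j" for i j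
    proof
      assume eq: "y i = y j"
      obtain l where l: "t i \<le> l" "l < t (Suc i)" "e \<le> ?d l" using tfar by blast
      then have "l < t j" using tmono[of "Suc i" j] that by simp
      then have "\<xi> i (int l) = (f ^^ l) z" "\<xi> j (int l) = (f ^^ l) x"
        using l by (simp_all add: \<xi>_def iter_of_nat)
      then have "e \<le> dist (\<xi> i (int l)) (\<xi> j (int l))" using l by simp
      also have "\<dots> < \<eta> + \<eta>"
        using y\<xi>[of "int l" i] y\<xi>[of "int l" j] eq
        by (smt (verit) dist_triangle3)
      finally show False using \<eta> by simp
    qed
    show "dist (iter k (y 0)) (iter k (y i)) \<le> c" for i k
    proof -
      have "dist (\<xi> 0 k) (\<xi> i k) \<le> c / 4"
      proof (cases "int (t 0) \<le> k")
        case True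
        then obtain j where j: "k = int j" "j \<ge> t 0"
          by (metis nonneg_int_cases of_nat_0_le_iff of_nat_le_iff order_trans)
        then show ?thesis
          using K[of j] tK[of 0] c_pos by (auto simp: \<xi>_def iter_of_nat)
      next
        case False
        then show ?thesis using tmono[of 0 i] c_pos by (simp add: \<xi>_def)
      qed
      moreover have "dist (iter k (y 0)) (iter k (y i)) \<le>
          dist (iter k (y 0)) (\<xi> 0 k) + dist (\<xi> 0 k) (\<xi> i k) + dist (iter k (y i)) (\<xi> i k)"
        by (smt (verit) dist_triangle dist_commute)
      ultimately show ?thesis using y\<xi>[of k 0] y\<xi>[of k i] \<eta>(3) c_pos by linarith
    qed
  qed (use y in auto)
qed

section \<open>Nested annuli\<close>

text \<open>
  The sequence \<open>t\<close> consists of outer radii: orbit number \<open>i\<close> is eventually at a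
  distance between \<open>2 t\<^bsub>i+1\<^esub>\<close> and \<open>t\<^bsub>i\<^esub>\<close> from that of \<open>x\<close>. The factor \<open>2\<close> leaves a gap of
  \<open>t\<^bsub>i+1\<^esub>\<close> to all later annuli.
\<close>

lemma close_orbits_asymptotic:
  assumes shadowing: "shadowing_property X f" and x: "x \<in> X"
  shows "\<exists>\<epsilon>>0. \<forall>z\<in>X. eventually (\<lambda>k. dist ((f ^^ k) z) ((f ^^ k) x) \<le> \<epsilon>) sequentially \<longrightarrow>
           (\<lambda>k. dist ((f ^^ k) z) ((f ^^ k) x)) \<longlonglongrightarrow> 0"
proof (rule ccontr)
  let ?d = "\<lambda>z k. dist ((f ^^ k) z) ((f ^^ k) x)"
  assume contra: "\<not> ?thesis"
  have step: "\<exists>s z. (0 < s \<and> s \<le> c / 4) \<and> s \<le> e \<and> z \<in> X \<and>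
      eventually (\<lambda>k. 2 * s \<le> ?d z k \<and> ?d z k \<le> e) sequentially"
    if e: "0 < e \<and> e \<le> c / 4" for e
  proof -
    obtain z where z: "z \<in> X" and le: "eventually (\<lambda>k. ?d z k \<le> e) sequentially"
      and nlim: "\<not> ?d z \<longlonglongrightarrow> 0"
      using contra e by blast
    have "eventually (\<lambda>k. ?d z k \<le> c / 4) sequentially"
      using le by eventually_elim (use e in linarith)
    then obtain a where a: "a > 0" and far: "eventually (\<lambda>k. a \<le> ?d z k) sequentially"
      using proximal_imp_asymptotic[OF shadowing x z] nlim
      by (auto simp: frequently_def not_less)
    define s where "s = min (a / 2) e"
    have "eventually (\<lambda>k. 2 * s \<le> ?d z k \<and> ?d z k \<le> e) sequentially"
      using far le by eventually_elim (auto simp: s_def)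
    moreover have "0 < s" "s \<le> c / 4" "s \<le> e" using a e by (auto simp: s_def)
    ultimately show ?thesis using z by blast
  qed
  have "\<exists>t. \<forall>i. (0 < t i \<and> t i \<le> c / 4) \<and> (t (Suc i) \<le> t i \<and>
      (\<exists>z\<in>X. eventually (\<lambda>k. 2 * t (Suc i) \<le> ?d z k \<and> ?d z k \<le> t i) sequentially))"
  proof (rule dependent_nat_choice)
    show "\<exists>e. 0 < e \<and> e \<le> c / 4" using c_pos by (intro exI[of _ "c / 4"]) auto
  qed (use step in blast)
  then obtain t :: "nat \<Rightarrow> real" where tz: "\<forall>i. (0 < t i \<and> t i \<le> c / 4) \<and> (t (Suc i) \<le> t i \<and>
      (\<exists>z\<in>X. eventually (\<lambda>k. 2 * t (Suc i) \<le> ?d z k \<and> ?d z k \<le> t i) sequentially))" ..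
  then have t: "\<And>i. 0 < t i" "\<And>i. t i \<le> c / 4" and tdec: "\<And>i. t (Suc i) \<le> t i"
    by simp_all
  have "\<forall>i. \<exists>z. z \<in> X \<and>
      eventually (\<lambda>k. 2 * t (Suc i) \<le> ?d z k \<and> ?d z k \<le> t i) sequentially"
  proof
    show "\<exists>z. z \<in> X \<and>
        eventually (\<lambda>k. 2 * t (Suc i) \<le> ?d z k \<and> ?d z k \<le> t i) sequentially" for i
      using spec[OF tz, of i] by (simp only: Bex_def)
  qed
  from choice[OF this] obtain z where z: "\<And>i. z i \<in> X"
    and ann: "\<And>i. eventually (\<lambda>k. 2 * t (Suc i) \<le> ?d (z i) k \<and> ?d (z i) k \<le> t i) sequentially"
    by auto
  show False
  proof (rule no_separated_forward_orbits[of z])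
    fix i
    show "eventually (\<lambda>k. dist ((f ^^ k) (z 0)) ((f ^^ k) (z i)) \<le> c) sequentially"
      using ann[of 0] ann[of i]
    proof eventually_elim
      case (elim k)
      then show ?case
        using dist_triangle2[of "(f ^^ k) (z 0)" "(f ^^ k) (z i)" "(f ^^ k) x"] t(2)[of 0]
          t(2)[of i] c_pos by linarith
    qed
  next
    fix i j :: nat assume "i < j"
    then have "t j \<le> t (Suc i)" using lift_Suc_antimono_le[of t, OF tdec] by simp
    have "eventually (\<lambda>k. t (Suc i) \<le> dist ((f ^^ k) (z i)) ((f ^^ k) (z j))) sequentially"
      using ann[of i] ann[of j]
    proof eventually_elim
      case (elim k)
      then show ?case
        using dist_triangle[of "(f ^^ k) (z i)" "(f ^^ k) x" "(f ^^ k) (z j)"]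
          \<open>t j \<le> t (Suc i)\<close> by linarith
    qed
    then show "\<exists>g>0. eventually (\<lambda>k. g \<le> dist ((f ^^ k) (z i)) ((f ^^ k) (z j))) sequentially"
      using t(1) by blast
  qed (use z in auto)
qed

end

theorem theorem2:
  fixes X :: "'a::metric_space set" and f :: "'a \<Rightarrow> 'a" and n :: nat
  assumes "n \<ge> 1"
    and "compact X"
    and "homeomorphism X X f (inv_into X f)"
    and "n_expansive n X f"
    and "shadowing_property X f"
  shows "\<forall>x\<in>X. \<exists>\<epsilon>>0. \<forall>m::int.
           local_stable_set X f \<epsilon> (int_iter X f m x) \<subseteq> stable_set X f (int_iter X f m x)"
proof
  fix x assume x: "x \<in> X"
  obtain c where c: "c > 0"
    "\<And>x. x \<in> X \<Longrightarrow> finite (dynamic_ball X f x c) \<and> card (dynamic_ball X f x c) \<le> n"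
    using assms(4) unfolding n_expansive_def by blast
  interpret n_expansive_homeomorphism X f n c
    using assms(2,3) c by unfold_locales auto
  obtain \<epsilon> where "\<epsilon> > 0"
    and asym: "\<And>z. z \<in> X \<Longrightarrow> eventually (\<lambda>k. dist ((f ^^ k) z) ((f ^^ k) x) \<le> \<epsilon>) sequentially \<Longrightarrow>
      (\<lambda>k. dist ((f ^^ k) z) ((f ^^ k) x)) \<longlonglongrightarrow> 0"
    using close_orbits_asymptotic[OF assms(5) x] by blast
  have "y \<in> stable_set X f (iter m x)" if "y \<in> local_stable_set X f \<epsilon> (iter m x)" for m y
  proof -
    have y: "y \<in> X" and le: "\<And>k. k \<ge> 1 \<Longrightarrow> dist ((f ^^ k) y) ((f ^^ k) (iter m x)) \<le> \<epsilon>"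
      using that by (auto simp: local_stable_set_def)
    define z where "z = iter (- m) y"
    have z: "z \<in> X" using y by (simp add: z_def iter_in)
    have yz: "y = iter m z"
      using iter_add[OF y, of m "- m"] iter_of_nat[of 0 y] by (simp add: z_def)
    (* The two sequences of distances differ by an index shift m of either sign. Writing m = a - b
       with natural a and b, time k + b for y is time k + a for z. *)
    define a b where "a = nat m" and "b = nat (- m)"
    have shift: "(f ^^ (k + b)) (iter m w) = (f ^^ (k + a)) w" if "w \<in> X" for k w
    proof -
      have "int (k + a) = int (k + b) + m" by (simp add: a_def b_def)
      then show ?thesis using iter_add[OF that, of "int (k + b)" m] by (metis iter_of_nat)
    qed
    have "dist ((f ^^ j) z) ((f ^^ j) x) \<le> \<epsilon>" if "j \<ge> a + 1" for j
    proof -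
      define k where "k = j - a"
      have k: "k + b \<ge> 1" "j = k + a" using that by (simp_all add: k_def)
      show ?thesis using le[OF k(1)] by (simp only: k(2) yz shift[OF z] shift[OF x])
    qed
    then have "eventually (\<lambda>k. dist ((f ^^ k) z) ((f ^^ k) x) \<le> \<epsilon>) sequentially"
      by (auto simp: eventually_sequentially)
    then have "(\<lambda>k. dist ((f ^^ k) z) ((f ^^ k) x)) \<longlonglongrightarrow> 0"
      by (rule asym[OF z])
    then have "(\<lambda>k. dist ((f ^^ (k + a)) z) ((f ^^ (k + a)) x)) \<longlonglongrightarrow> 0"
      by (rule LIMSEQ_ignore_initial_segment)
    then have "(\<lambda>k. dist ((f ^^ (k + b)) y) ((f ^^ (k + b)) (iter m x))) \<longlonglongrightarrow> 0"
      by (simp only: yz shift[OF z] shift[OF x])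
    then have "(\<lambda>k. dist ((f ^^ k) y) ((f ^^ k) (iter m x))) \<longlonglongrightarrow> 0"
      by (rule LIMSEQ_offset)
    then show ?thesis using y by (simp add: stable_set_def)
  qed
  then show "\<exists>\<epsilon>>0. \<forall>m::int.
      local_stable_set X f \<epsilon> (iter m x) \<subseteq> stable_set X f (iter m x)"
    using \<open>\<epsilon> > 0\<close> by blast
qed

end
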